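(* Let $R$ be a ring with unity, let $\mathcal{X}$ be a semibrick of left $R$-modules, and let $M,N\in\mathrm{Filt}(\mathcal{X})$. Then every homomorphism $f\in\mathrm{Hom}(M,N)$ is a homomorphism of the $\mathcal{X}$-socle filtered objects; that is, if $(M_\lambda,\lambda\le\mu)$ and $(N_\lambda,\lambda\le\nu)$ are the $\mathcal{X}$-socle filtrations of $M$ and $N$, and $N_\lambda:=N$ for $\lambda>\nu$, then $f(M_\lambda)\subseteq N_\lambda$ for all $\lambda\le\mu$.
   Context: A brick is a finitely presented left $R$-module whose endomorphism ring is a division ring. A semibrick is a class $\mathcal{X}$ of pairwise non-isomorphic bricks with $\mathrm{Hom}(X,X')=0$ for distinct $X,X'\in\mathcal{X}$. A filtration of a module $M$ is an ascending chain $(M_\lambda,\lambda\le\mu)$ of submodules ($\mu$ an ordinal) with $M_0=0$, $M_\mu=M$ and $M_\nu=\bigcup_{\lambda<\nu}M_\lambda$ for limit ordinals $\nu\le\mu$. It is an $\mathcal{X}$-filtration if each $M_{\lambda+1}/M_\lambda$ ($\lambda<\mu$) is isomorphic to a module in $\mathcal{X}$. $\mathrm{Filt}(\mathcal{X})$ is the class of modules admitting an $\mathcal{X}$-filtration. For a module $N$ put $\mathrm{soc}_{\mathcal{X}}N=\sum_{X\in\mathcal{X},\,f\in\mathrm{Hom}(X,N)}\mathrm{Im}\,f$. The $\mathcal{X}$-socle filtration $(V_\lambda,\lambda\le\mu)$ of $M\in\mathrm{Filt}(\mathcal{X})$ is defined inductively by $V_0=0$, $V_{\lambda+1}$ the preimage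 of $\mathrm{soc}_{\mathcal{X}}(M/V_\lambda)$ under $M\to M/V_\lambda$, and $V_\lambda=\bigcup_{\alpha<\lambda}V_\alpha$ for limit ordinals $\lambda$, up to an ordinal $\mu$ with $V_\mu=M$. *)

theory Defs
  imports "HOL-Algebra.Module" "HOL-Algebra.AbelCoset"
begin

section \<open>Left modules over a ring with unity\<close>

text \<open>
  The library locale \<open>module\<close> assumes a commutative ring of scalars, so left modules over
  an arbitrary unital ring are introduced here, on the library's record type \<open>module\<close>. As in the
  library, the \<open>mult\<close> and \<open>one\<close> fields of that record carry no meaning for modules. The library
  locale \<open>submodule\<close> does not assume commutativity and is used as it is.
\<close>

locale left_module = R?: ring R + M?: abelian_group M
  for R :: "('a, 'r) ring_scheme" (structure) and M :: "('a, 'm) module" (structure) +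
  assumes smult_closed:
      "\<lbrakk>a \<in> carrier R; x \<in> carrier M\<rbrakk> \<Longrightarrow> a \<odot>\<^bsub>M\<^esub> x \<in> carrier M"
    and smult_l_distr:
      "\<lbrakk>a \<in> carrier R; b \<in> carrier R; x \<in> carrier M\<rbrakk>
        \<Longrightarrow> (a \<oplus>\<^bsub>R\<^esub> b) \<odot>\<^bsub>M\<^esub> x = a \<odot>\<^bsub>M\<^esub> x \<oplus>\<^bsub>M\<^esub> b \<odot>\<^bsub>M\<^esub> x"
    and smult_r_distr:
      "\<lbrakk>a \<in> carrier R; x \<in> carrier M; y \<in> carrier M\<rbrakk>
        \<Longrightarrow> a \<odot>\<^bsub>M\<^esub> (x \<oplus>\<^bsub>M\<^esub> y) = a \<odot>\<^bsub>M\<^esub> x \<oplus>\<^bsub>M\<^esub> a \<odot>\<^bsub>M\<^esub> y"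
    and smult_assoc:
      "\<lbrakk>a \<in> carrier R; b \<in> carrier R; x \<in> carrier M\<rbrakk>
        \<Longrightarrow> (a \<otimes>\<^bsub>R\<^esub> b) \<odot>\<^bsub>M\<^esub> x = a \<odot>\<^bsub>M\<^esub> (b \<odot>\<^bsub>M\<^esub> x)"
    and smult_one:
      "x \<in> carrier M \<Longrightarrow> \<one>\<^bsub>R\<^esub> \<odot>\<^bsub>M\<^esub> x = x"

definition Hom :: "('a, 'r) ring_scheme \<Rightarrow> ('a, 'm) module \<Rightarrow> ('a, 'n) module \<Rightarrow> ('m \<Rightarrow> 'n) set"
  where "Hom R M N =
    {f \<in> carrier M \<rightarrow> carrier N.
      (\<forall>x\<in>carrier M. \<forall>y\<in>carrier M. f (x \<oplus>\<^bsub>M\<^esub> y) = f x \<oplus>\<^bsub>N\<^esub> f y) \<and>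
      (\<forall>a\<in>carrier R. \<forall>x\<in>carrier M. f (a \<odot>\<^bsub>M\<^esub> x) = a \<odot>\<^bsub>N\<^esub> f x)}"

definition isomorphic :: "('a, 'r) ring_scheme \<Rightarrow> ('a, 'm) module \<Rightarrow> ('a, 'n) module \<Rightarrow> bool"
  where "isomorphic R M N \<longleftrightarrow> (\<exists>f\<in>Hom R M N. bij_betw f (carrier M) (carrier N))"

definition quot_module :: "('a, 'm) module \<Rightarrow> 'm set \<Rightarrow> ('a, 'm set) module"
  where "quot_module M H =
    \<lparr>carrier = A_RCOSETS M H, mult = undefined, one = undefined,
     zero = H, add = set_add M,
     smult = (\<lambda>a C. \<Union>x\<in>C. a_r_coset M H (a \<odot>\<^bsub>M\<^esub> x))\<rparr>"

text \<open>The free left module \<open>R\<^sup>n\<close>; its elements are extensional functions on \<open>{..<n}\<close>.\<close>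

definition free_module :: "('a, 'r) ring_scheme \<Rightarrow> nat \<Rightarrow> ('a, nat \<Rightarrow> 'a) module"
  where "free_module R n =
    \<lparr>carrier = {..<n} \<rightarrow>\<^sub>E carrier R, mult = undefined, one = undefined,
     zero = (\<lambda>i\<in>{..<n}. \<zero>\<^bsub>R\<^esub>),
     add = (\<lambda>v w. \<lambda>i\<in>{..<n}. v i \<oplus>\<^bsub>R\<^esub> w i),
     smult = (\<lambda>a v. \<lambda>i\<in>{..<n}. a \<otimes>\<^bsub>R\<^esub> v i)\<rparr>"

text \<open>There is an exact sequence \<open>R\<^sup>m \<rightarrow> R\<^sup>n \<rightarrow> M \<rightarrow> 0\<close>.\<close>

definition finitely_presented :: "('a, 'r) ring_scheme \<Rightarrow> ('a, 'm) module \<Rightarrow> bool"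
  where "finitely_presented R M \<longleftrightarrow>
    (\<exists>m n. \<exists>q\<in>Hom R (free_module R m) (free_module R n). \<exists>p\<in>Hom R (free_module R n) M.
       q ` carrier (free_module R m) = {v \<in> carrier (free_module R n). p v = \<zero>\<^bsub>M\<^esub>} \<and>
       p ` carrier (free_module R n) = carrier M)"

text \<open>
  Endomorphisms are taken extensional, so that equal maps on the carrier are equal elements
  of the endomorphism ring.
\<close>

definition endo_ring :: "('a, 'r) ring_scheme \<Rightarrow> ('a, 'm) module \<Rightarrow> ('m \<Rightarrow> 'm) ring"
  where "endo_ring R M =
    \<lparr>carrier = Hom R M M \<inter> extensional (carrier M),
     mult = compose (carrier M),
     one = (\<lambda>x\<in>carrier M. x),
     zero = (\<lambda>x\<in>carrier M. \<zero>\<^bsub>M\<^esub>),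
     add = (\<lambda>f g. \<lambda>x\<in>carrier M. f x \<oplus>\<^bsub>M\<^esub> g x)\<rparr>"

text \<open>The library's locale \<open>field\<close> without commutativity.\<close>

definition is_division_ring :: "('d, 'e) ring_scheme \<Rightarrow> bool"
  where "is_division_ring D \<longleftrightarrow>
    ring D \<and> \<one>\<^bsub>D\<^esub> \<noteq> \<zero>\<^bsub>D\<^esub> \<and> Units D = carrier D - {\<zero>\<^bsub>D\<^esub>}"

section \<open>Semibricks\<close>

definition brick :: "('a, 'r) ring_scheme \<Rightarrow> ('a, 'm) module \<Rightarrow> bool"
  where "brick R M \<longleftrightarrow>
    left_module R M \<and> finitely_presented R M \<and> is_division_ring (endo_ring R M)"

text \<open>
  A class of pairwise non-isomorphic finitely presented modules is a set up to isomorphism, so a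
  semibrick is a set of modules on some carrier type.
\<close>

definition semibrick :: "('a, 'r) ring_scheme \<Rightarrow> ('a, 'x) module set \<Rightarrow> bool"
  where "semibrick R \<X> \<longleftrightarrow>
    (\<forall>X\<in>\<X>. brick R X) \<and>
    (\<forall>X\<in>\<X>. \<forall>X'\<in>\<X>. X \<noteq> X' \<longrightarrow>
       \<not> isomorphic R X X' \<and> (\<forall>f\<in>Hom R X X'. \<forall>x\<in>carrier X. f x = \<zero>\<^bsub>X'\<^esub>))"

section \<open>Filtrations\<close>

text \<open>
  Ordinals are the elements of an arbitrary well-ordered type \<open>'o\<close>. Every ordinal is the order
  type of an initial segment of such a type, so nothing is lost as long as \<open>'o\<close> is universally
  quantified. The successor of \<open>\<alpha>\<close> is used only if some \<open>\<mu> > \<alpha>\<close> exists.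
\<close>

definition ord_zero :: "'o::wellorder"
  where "ord_zero = (LEAST \<alpha>. True)"

definition ord_succ :: "'o::wellorder \<Rightarrow> 'o"
  where "ord_succ \<alpha> = (LEAST \<beta>. \<alpha> < \<beta>)"

definition ord_limit :: "'o::wellorder \<Rightarrow> bool"
  where "ord_limit \<beta> \<longleftrightarrow> (\<exists>\<alpha>. \<alpha> < \<beta>) \<and> (\<forall>\<alpha><\<beta>. \<exists>\<gamma><\<beta>. \<alpha> < \<gamma>)"

text \<open>In the predicates below only the values of \<open>F\<close> and \<open>V\<close> on \<open>{..\<mu>}\<close> matter.\<close>

definition filtration ::
  "('a, 'r) ring_scheme \<Rightarrow> ('a, 'm) module \<Rightarrow> 'o::wellorder \<Rightarrow> ('o \<Rightarrow> 'm set) \<Rightarrow> bool"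
  where "filtration R M \<mu> F \<longleftrightarrow>
    (\<forall>\<alpha>\<le>\<mu>. submodule (F \<alpha>) R M) \<and>
    (\<forall>\<alpha> \<beta>. \<alpha> \<le> \<beta> \<and> \<beta> \<le> \<mu> \<longrightarrow> F \<alpha> \<subseteq> F \<beta>) \<and>
    F ord_zero = {\<zero>\<^bsub>M\<^esub>} \<and>
    F \<mu> = carrier M \<and>
    (\<forall>\<beta>\<le>\<mu>. ord_limit \<beta> \<longrightarrow> F \<beta> = (\<Union>\<alpha>\<in>{..<\<beta>}. F \<alpha>))"

definition X_filtration ::
  "('a, 'r) ring_scheme \<Rightarrow> ('a, 'x) module set \<Rightarrow> ('a, 'm) module
    \<Rightarrow> 'o::wellorder \<Rightarrow> ('o \<Rightarrow> 'm set) \<Rightarrow> bool"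
  where "X_filtration R \<X> M \<mu> F \<longleftrightarrow>
    filtration R M \<mu> F \<and>
    (\<forall>\<alpha><\<mu>. \<exists>X\<in>\<X>.
       isomorphic R (quot_module (M\<lparr>carrier := F (ord_succ \<alpha>)\<rparr>) (F \<alpha>)) X)"

text \<open>
  \<open>Filt TYPE('o) R \<X>\<close>: the modules on \<open>'m\<close> with an \<open>\<X>\<close>-filtration whose length is an ordinal
  in \<open>'o\<close>. A statement with hypothesis \<open>M \<in> Filt TYPE('o) R \<X>\<close>, in which \<open>'o\<close> is a type
  variable not otherwise used, is about modules with an \<open>\<X>\<close>-filtration of any length.
\<close>

definition Filt ::
  "'o::wellorder itself \<Rightarrow> ('a, 'r) ring_scheme \<Rightarrow> ('a, 'x) module set \<Rightarrow> ('a, 'm) module set"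
  where "Filt _ R \<X> =
    {M. left_module R M \<and> (\<exists>(\<mu>::'o) F. X_filtration R \<X> M \<mu> F)}"

text \<open>
  The sum of the submodules \<open>f ` carrier X\<close> of \<open>N\<close> is the smallest submodule of \<open>N\<close> containing
  all of them.
\<close>

definition soc ::
  "('a, 'r) ring_scheme \<Rightarrow> ('a, 'x) module set \<Rightarrow> ('a, 'm) module \<Rightarrow> 'm set"
  where "soc R \<X> N =
    \<Inter>{H. submodule H R N \<and> (\<forall>X\<in>\<X>. \<forall>f\<in>Hom R X N. f ` carrier X \<subseteq> H)}"

definition socle_filtration ::
  "('a, 'r) ring_scheme \<Rightarrow> ('a, 'x) module set \<Rightarrow> ('a, 'm) module
    \<Rightarrow> 'o::wellorder \<Rightarrow> ('o \<Rightarrow> 'm set) \<Rightarrow> bool"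
  where "socle_filtration R \<X> M \<mu> V \<longleftrightarrow>
    V ord_zero = {\<zero>\<^bsub>M\<^esub>} \<and>
    (\<forall>\<alpha><\<mu>. V (ord_succ \<alpha>) =
       {x \<in> carrier M. a_r_coset M (V \<alpha>) x \<in> soc R \<X> (quot_module M (V \<alpha>))}) \<and>
    (\<forall>\<beta>\<le>\<mu>. ord_limit \<beta> \<longrightarrow> V \<beta> = (\<Union>\<alpha>\<in>{..<\<beta>}. V \<alpha>)) \<and>
    V \<mu> = carrier M"

end

theory Submission
  imports Defs
begin

text \<open>
  The \<open>\<X>\<close>-socle is functorial: composing with \<open>g : P \<rightarrow> Q\<close> sends homomorphisms \<open>X \<rightarrow> P\<close> to
  homomorphisms \<open>X \<rightarrow> Q\<close>, so \<open>g\<close> maps \<open>soc P\<close> into \<open>soc Q\<close>. By transfinite induction, if \<open>f\<close> maps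
  \<open>V\<^sub>\<alpha>\<close> into \<open>W\<^sub>\<alpha>\<close>, it induces a homomorphism \<open>M/V\<^sub>\<alpha> \<rightarrow> N/W\<^sub>\<alpha>\<close>; functoriality of the socle
  along this map gives the successor step.
\<close>

lemma ord_cases:
  fixes \<alpha> :: "'o::wellorder"
  obtains (zero) "\<alpha> = ord_zero"
  | (succ) \<beta> where "\<beta> < \<alpha>" "\<alpha> = ord_succ \<beta>"
  | (limit) "ord_limit \<alpha>"
proof -
  consider "\<not> (\<exists>\<beta>. \<beta> < \<alpha>)" | "ord_limit \<alpha>" | \<beta> where "\<beta> < \<alpha>" "\<forall>\<gamma><\<alpha>. \<not> \<beta> < \<gamma>"
    unfolding ord_limit_def by blast
  then show thesis
  proof cases
    case 1
    then have "\<alpha> = ord_zero"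
      unfolding ord_zero_def by (intro Least_equality[symmetric]) (auto simp: not_less)
    then show thesis by (rule zero)
  next
    case 2
    then show thesis by (rule limit)
  next
    case 3
    then have "\<alpha> = ord_succ \<beta>"
      unfolding ord_succ_def by (intro Least_equality[symmetric]) (auto simp: not_less[symmetric])
    with 3 show thesis by (intro succ)
  qed
qed

lemma HomI:
  assumes "\<And>x. x \<in> carrier M \<Longrightarrow> f x \<in> carrier N"
    and "\<And>x y. \<lbrakk>x \<in> carrier M; y \<in> carrier M\<rbrakk> \<Longrightarrow> f (x \<oplus>\<^bsub>M\<^esub> y) = f x \<oplus>\<^bsub>N\<^esub> f y"
    and "\<And>a x. \<lbrakk>a \<in> carrier R; x \<in> carrier M\<rbrakk> \<Longrightarrow> f (a \<odot>\<^bsub>M\<^esub> x) = a \<odot>\<^bsub>N\<^esub> f x"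
  shows "f \<in> Hom R M N"
  using assms by (auto simp: Hom_def)

lemma
  assumes "f \<in> Hom R M N"
  shows Hom_closed: "x \<in> carrier M \<Longrightarrow> f x \<in> carrier N"
    and Hom_add: "\<lbrakk>x \<in> carrier M; y \<in> carrier M\<rbrakk> \<Longrightarrow> f (x \<oplus>\<^bsub>M\<^esub> y) = f x \<oplus>\<^bsub>N\<^esub> f y"
    and Hom_smult: "\<lbrakk>a \<in> carrier R; x \<in> carrier M\<rbrakk> \<Longrightarrow> f (a \<odot>\<^bsub>M\<^esub> x) = a \<odot>\<^bsub>N\<^esub> f x"
  using assms by (auto simp: Hom_def)

lemma Hom_comp: "\<lbrakk>f \<in> Hom R L M; g \<in> Hom R M N\<rbrakk> \<Longrightarrow> g \<circ> f \<in> Hom R L N"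
  by (auto intro!: HomI simp: Hom_closed Hom_add Hom_smult)

lemma Hom_zero:
  assumes "left_module R M" "left_module R N" "f \<in> Hom R M N"
  shows "f \<zero>\<^bsub>M\<^esub> = \<zero>\<^bsub>N\<^esub>"
proof -
  interpret M: left_module R M by fact
  interpret N: left_module R N by fact
  have "f \<zero>\<^bsub>M\<^esub> \<oplus>\<^bsub>N\<^esub> f \<zero>\<^bsub>M\<^esub> = f \<zero>\<^bsub>M\<^esub>"
    using Hom_add[OF assms(3), of "\<zero>\<^bsub>M\<^esub>" "\<zero>\<^bsub>M\<^esub>"] Hom_closed[OF assms(3)] by simp
  then show ?thesis
    using Hom_closed[OF assms(3)] by (metis N.add.l_cancel_one M.M.zero_closed)
qed

context left_module
begin

lemma smult_minus_one:
  assumes "x \<in> carrier M"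
  shows "(\<ominus>\<^bsub>R\<^esub> \<one>\<^bsub>R\<^esub>) \<odot>\<^bsub>M\<^esub> x = \<ominus>\<^bsub>M\<^esub> x"
proof -
  have zero: "\<zero>\<^bsub>R\<^esub> \<odot>\<^bsub>M\<^esub> x = \<zero>\<^bsub>M\<^esub>"
  proof -
    have "\<zero>\<^bsub>R\<^esub> \<odot>\<^bsub>M\<^esub> x \<oplus>\<^bsub>M\<^esub> \<zero>\<^bsub>R\<^esub> \<odot>\<^bsub>M\<^esub> x = \<zero>\<^bsub>R\<^esub> \<odot>\<^bsub>M\<^esub> x"
      using assms smult_l_distr[of "\<zero>\<^bsub>R\<^esub>" "\<zero>\<^bsub>R\<^esub>" x] by (simp add: smult_closed)
    then show ?thesis
      using assms by (metis M.add.l_cancel_one R.zero_closed smult_closed)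
  qed
  have "(\<ominus>\<^bsub>R\<^esub> \<one>\<^bsub>R\<^esub>) \<odot>\<^bsub>M\<^esub> x \<oplus>\<^bsub>M\<^esub> x = \<zero>\<^bsub>M\<^esub>"
    using assms smult_l_distr[of "\<ominus>\<^bsub>R\<^esub> \<one>\<^bsub>R\<^esub>" "\<one>\<^bsub>R\<^esub>" x] zero by (simp add: smult_one R.l_neg)
  then show ?thesis
    using assms by (metis M.minus_equality smult_closed R.a_inv_closed R.one_closed)
qed

lemma submoduleI:
  assumes "H \<subseteq> carrier M"
    and "\<zero>\<^bsub>M\<^esub> \<in> H"
    and "\<And>x y. \<lbrakk>x \<in> H; y \<in> H\<rbrakk> \<Longrightarrow> x \<oplus>\<^bsub>M\<^esub> y \<in> H"
    and "\<And>a x. \<lbrakk>a \<in> carrier R; x \<in> H\<rbrakk> \<Longrightarrow> a \<odot>\<^bsub>M\<^esub> x \<in> H"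
  shows "submodule H R M"
proof -
  have "\<ominus>\<^bsub>M\<^esub> x \<in> H" if "x \<in> H" for x
    using that assms(1) assms(4)[of "\<ominus>\<^bsub>R\<^esub> \<one>\<^bsub>R\<^esub>" x] smult_minus_one[of x] by auto
  with assms show ?thesis
    by (intro submodule.intro subgroup.intro submodule_axioms.intro) (simp_all add: a_inv_def)
qed

lemma
  assumes "submodule H R M"
  shows submodule_subset: "H \<subseteq> carrier M"
    and submodule_zero: "\<zero>\<^bsub>M\<^esub> \<in> H"
    and submodule_add: "\<lbrakk>x \<in> H; y \<in> H\<rbrakk> \<Longrightarrow> x \<oplus>\<^bsub>M\<^esub> y \<in> H"
    and submodule_smult: "\<lbrakk>a \<in> carrier R; x \<in> H\<rbrakk> \<Longrightarrow> a \<odot>\<^bsub>M\<^esub> x \<in> H"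
    and submodule_abelian_subgroup: "abelian_subgroup H M"
proof -
  interpret submodule H R M by fact
  show "H \<subseteq> carrier M" "\<zero>\<^bsub>M\<^esub> \<in> H" "\<lbrakk>x \<in> H; y \<in> H\<rbrakk> \<Longrightarrow> x \<oplus>\<^bsub>M\<^esub> y \<in> H"
    "\<lbrakk>a \<in> carrier R; x \<in> H\<rbrakk> \<Longrightarrow> a \<odot>\<^bsub>M\<^esub> x \<in> H"
    using subset one_closed m_closed smult_closed by auto
  show "abelian_subgroup H M"
    by (intro abelian_subgroupI3 additive_subgroupI is_subgroup M.abelian_group_axioms)
qed

lemma zero_submodule: "submodule {\<zero>\<^bsub>M\<^esub>} R M"
proof (rule submoduleI)
  fix a x assume a: "a \<in> carrier R" and "x \<in> {\<zero>\<^bsub>M\<^esub>}"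
  have "a \<odot>\<^bsub>M\<^esub> \<zero>\<^bsub>M\<^esub> \<oplus>\<^bsub>M\<^esub> a \<odot>\<^bsub>M\<^esub> \<zero>\<^bsub>M\<^esub> = a \<odot>\<^bsub>M\<^esub> \<zero>\<^bsub>M\<^esub>"
    using a smult_r_distr[of a "\<zero>\<^bsub>M\<^esub>" "\<zero>\<^bsub>M\<^esub>"] by (simp add: smult_closed)
  then have "a \<odot>\<^bsub>M\<^esub> \<zero>\<^bsub>M\<^esub> = \<zero>\<^bsub>M\<^esub>"
    using a by (metis M.add.l_cancel_one M.zero_closed smult_closed)
  with \<open>x \<in> _\<close> show "a \<odot>\<^bsub>M\<^esub> x \<in> {\<zero>\<^bsub>M\<^esub>}" by simp
qed auto

lemma carrier_submodule: "submodule (carrier M) R M"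
  by (rule submoduleI) (auto simp: smult_closed)

lemma Inter_submodule:
  assumes "\<H> \<noteq> {}" and "\<And>H. H \<in> \<H> \<Longrightarrow> submodule H R M"
  shows "submodule (\<Inter>\<H>) R M"
  using assms
  by (intro submoduleI) (auto intro: submodule_zero submodule_add submodule_smult dest: submodule_subset)

lemma Union_chain_submodule:
  assumes "I \<noteq> {}" and "\<And>i. i \<in> I \<Longrightarrow> submodule (F i) R M"
    and "\<And>i j. \<lbrakk>i \<in> I; j \<in> I\<rbrakk> \<Longrightarrow> F i \<subseteq> F j \<or> F j \<subseteq> F i"
  shows "submodule (\<Union>i\<in>I. F i) R M"
proof (rule submoduleI)
  show "(\<Union>i\<in>I. F i) \<subseteq> carrier M" using assms(2) submodule_subset by blast
  show "\<zero>\<^bsub>M\<^esub> \<in> (\<Union>i\<in>I. F i)" using assms(1,2) submodule_zero by blast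
  show "a \<odot>\<^bsub>M\<^esub> x \<in> (\<Union>i\<in>I. F i)" if "a \<in> carrier R" "x \<in> (\<Union>i\<in>I. F i)" for a x
    using that assms(2) submodule_smult by blast
next
  fix x y assume "x \<in> (\<Union>i\<in>I. F i)" "y \<in> (\<Union>i\<in>I. F i)"
  then obtain i j where "i \<in> I" "j \<in> I" "x \<in> F i" "y \<in> F j" by blast
  with assms(3)[of i j] obtain k where "k \<in> I" "x \<in> F k" "y \<in> F k" by blast
  then show "x \<oplus>\<^bsub>M\<^esub> y \<in> (\<Union>i\<in>I. F i)" using assms(2) submodule_add by blast
qed

end

lemma vimage_submodule:
  assumes "left_module R M" "left_module R N" "f \<in> Hom R M N" "submodule H R N"
  shows "submodule {x \<in> carrier M. f x \<in> H} R M"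
proof -
  interpret M: left_module R M by fact
  interpret N: left_module R N by fact
  show ?thesis
    using N.submodule_zero[OF assms(4)] N.submodule_add[OF assms(4)] N.submodule_smult[OF assms(4)]
    by (intro M.submoduleI)
      (auto simp: Hom_zero[OF assms(1-3)] Hom_add[OF assms(3)] Hom_smult[OF assms(3)] M.smult_closed)
qed

lemma quot_module_simps:
  "carrier (quot_module M H) = A_RCOSETS M H"
  "zero (quot_module M H) = H"
  "add (quot_module M H) = set_add M"
  "smult (quot_module M H) = (\<lambda>a C. \<Union>x\<in>C. a_r_coset M H (a \<odot>\<^bsub>M\<^esub> x))"
  by (simp_all add: quot_module_def)

context left_module
begin

context
  fixes H
  assumes H: "submodule H R M"
begin

interpretation H: abelian_subgroup H M
  by (rule submodule_abelian_subgroup[OF H])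

lemma quot_smult:
  assumes "a \<in> carrier R" "x \<in> carrier M"
  shows "a \<odot>\<^bsub>quot_module M H\<^esub> (H +>\<^bsub>M\<^esub> x) = H +>\<^bsub>M\<^esub> (a \<odot>\<^bsub>M\<^esub> x)"
proof -
  have "H +>\<^bsub>M\<^esub> (a \<odot>\<^bsub>M\<^esub> y) = H +>\<^bsub>M\<^esub> (a \<odot>\<^bsub>M\<^esub> x)" if "y \<in> H +>\<^bsub>M\<^esub> x" for y
  proof -
    from that obtain h where h: "h \<in> H" "y = h \<oplus>\<^bsub>M\<^esub> x" by (auto simp: a_r_coset_def')
    then have "a \<odot>\<^bsub>M\<^esub> y = a \<odot>\<^bsub>M\<^esub> h \<oplus>\<^bsub>M\<^esub> a \<odot>\<^bsub>M\<^esub> x"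
      using assms by (simp add: smult_r_distr)
    moreover have "a \<odot>\<^bsub>M\<^esub> h \<in> H" using submodule_smult[OF H] assms h by simp
    ultimately have "a \<odot>\<^bsub>M\<^esub> y \<in> H +>\<^bsub>M\<^esub> (a \<odot>\<^bsub>M\<^esub> x)" by (auto simp: a_r_coset_def')
    then show ?thesis
      using H.a_repr_independence' assms smult_closed by metis
  qed
  moreover have "x \<in> H +>\<^bsub>M\<^esub> x" using assms H.a_rcos_self by blast
  ultimately show ?thesis unfolding quot_module_simps by blast
qed

lemma quot_add:
  assumes "x \<in> carrier M" "y \<in> carrier M"
  shows "(H +>\<^bsub>M\<^esub> x) \<oplus>\<^bsub>quot_module M H\<^esub> (H +>\<^bsub>M\<^esub> y) = H +>\<^bsub>M\<^esub> (x \<oplus>\<^bsub>M\<^esub> y)"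
  using assms by (simp add: quot_module_simps H.a_rcos_sum)

lemma coset_mem_quot: "x \<in> carrier M \<Longrightarrow> H +>\<^bsub>M\<^esub> x \<in> carrier (quot_module M H)"
  by (auto simp: quot_module_simps A_RCOSETS_def')

lemma quot_cases:
  assumes "C \<in> carrier (quot_module M H)"
  obtains x where "x \<in> carrier M" "C = H +>\<^bsub>M\<^esub> x"
  using assms by (auto simp: quot_module_simps A_RCOSETS_def')

lemma left_module_quot: "left_module R (quot_module M H)"
proof (intro left_module.intro left_module_axioms.intro)
  have zero: "\<zero>\<^bsub>quot_module M H\<^esub> = H +>\<^bsub>M\<^esub> \<zero>\<^bsub>M\<^esub>"
    by (simp add: quot_module_simps H.a_rcos_const)
  show "abelian_group (quot_module M H)"
  proof (rule abelian_groupI)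
    fix C assume "C \<in> carrier (quot_module M H)"
    then obtain x where "x \<in> carrier M" "C = H +>\<^bsub>M\<^esub> x" by (rule quot_cases)
    then show "\<exists>D\<in>carrier (quot_module M H). D \<oplus>\<^bsub>quot_module M H\<^esub> C = \<zero>\<^bsub>quot_module M H\<^esub>"
      by (intro bexI[of _ "H +>\<^bsub>M\<^esub> (\<ominus>\<^bsub>M\<^esub> x)"])
        (simp_all add: quot_add coset_mem_quot zero M.l_neg)
  qed (auto elim!: quot_cases simp: zero quot_add coset_mem_quot M.a_ac)
qed (auto elim!: quot_cases simp: quot_smult quot_add coset_mem_quot smult_closed
    smult_l_distr smult_r_distr smult_assoc smult_one R.ring_axioms)

lemma coset_Hom: "(+>\<^bsub>M\<^esub>) H \<in> Hom R M (quot_module M H)"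
  by (rule HomI) (simp_all add: coset_mem_quot quot_add quot_smult)

end

end

lemma quot_Hom_lift:
  assumes M: "left_module R M" and N: "left_module R N" and f: "f \<in> Hom R M N"
    and H: "submodule H R M" and K: "submodule K R N" and sub: "f ` H \<subseteq> K"
  obtains g where "g \<in> Hom R (quot_module M H) (quot_module N K)"
    and "\<And>x. x \<in> carrier M \<Longrightarrow> g (H +>\<^bsub>M\<^esub> x) = K +>\<^bsub>N\<^esub> f x"
proof -
  interpret M: left_module R M by fact
  interpret N: left_module R N by fact
  interpret H: abelian_subgroup H M by (rule M.submodule_abelian_subgroup[OF H])
  interpret K: abelian_subgroup K N by (rule N.submodule_abelian_subgroup[OF K])
  define g where "g C = (\<Union>x\<in>C. K +>\<^bsub>N\<^esub> f x)" for C
  have g: "g (H +>\<^bsub>M\<^esub> x) = K +>\<^bsub>N\<^esub> f x" if x: "x \<in> carrier M" for x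
  proof -
    have "K +>\<^bsub>N\<^esub> f y = K +>\<^bsub>N\<^esub> f x" if y: "y \<in> H +>\<^bsub>M\<^esub> x" for y
    proof -
      from y obtain h where h: "h \<in> H" "y = h \<oplus>\<^bsub>M\<^esub> x" by (auto simp: a_r_coset_def')
      then have "f y = f h \<oplus>\<^bsub>N\<^esub> f x" using x f by (simp add: Hom_add)
      with h sub have "f y \<in> K +>\<^bsub>N\<^esub> f x" by (auto simp: a_r_coset_def')
      then show ?thesis using K.a_repr_independence' Hom_closed[OF f x] by metis
    qed
    moreover have "x \<in> H +>\<^bsub>M\<^esub> x" using x H.a_rcos_self by blast
    ultimately show ?thesis unfolding g_def by blast
  qed
  have "g \<in> Hom R (quot_module M H) (quot_module N K)"
    by (rule HomI)
      (auto elim!: M.quot_cases[OF H] simp: g M.quot_add[OF H] M.quot_smult[OF H] N.quot_add[OF K]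
        N.quot_smult[OF K] N.coset_mem_quot[OF K] Hom_closed[OF f] Hom_add[OF f] Hom_smult[OF f]
        M.smult_closed)
  with g show thesis by (intro that)
qed

lemma (in left_module) soc_submodule: "submodule (soc R \<X> M) R M"
  unfolding soc_def
proof (rule Inter_submodule)
  have "carrier M \<in> {H. submodule H R M \<and> (\<forall>X\<in>\<X>. \<forall>f\<in>Hom R X M. f ` carrier X \<subseteq> H)}"
    using carrier_submodule by (auto simp: Hom_closed)
  then show "{H. submodule H R M \<and> (\<forall>X\<in>\<X>. \<forall>f\<in>Hom R X M. f ` carrier X \<subseteq> H)} \<noteq> {}"
    by blast
qed blast

lemma Hom_soc:
  assumes "left_module R M" "left_module R N" "g \<in> Hom R M N"
  shows "g ` soc R \<X> M \<subseteq> soc R \<X> N"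
proof -
  have "soc R \<X> M \<subseteq> {x \<in> carrier M. g x \<in> H}"
    if H: "submodule H R N" and im: "\<And>X f. \<lbrakk>X \<in> \<X>; f \<in> Hom R X N\<rbrakk> \<Longrightarrow> f ` carrier X \<subseteq> H" for H
  proof -
    have "f ` carrier X \<subseteq> {x \<in> carrier M. g x \<in> H}" if "X \<in> \<X>" "f \<in> Hom R X M" for X f
      using im[OF that(1) Hom_comp[OF that(2) assms(3)]] Hom_closed[OF that(2)] by auto
    with vimage_submodule[OF assms H] show ?thesis
      unfolding soc_def by (intro Inter_lower) blast
  qed
  then show ?thesis unfolding soc_def[of R \<X> N] by blast
qed

lemma
  assumes "socle_filtration R \<X> M \<mu> V"
  shows socle_filtration_zero: "V ord_zero = {\<zero>\<^bsub>M\<^esub>}"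
    and socle_filtration_succ: "\<alpha> < \<mu> \<Longrightarrow> V (ord_succ \<alpha>) =
       {x \<in> carrier M. V \<alpha> +>\<^bsub>M\<^esub> x \<in> soc R \<X> (quot_module M (V \<alpha>))}"
    and socle_filtration_limit: "\<lbrakk>\<beta> \<le> \<mu>; ord_limit \<beta>\<rbrakk> \<Longrightarrow> V \<beta> = (\<Union>\<alpha>\<in>{..<\<beta>}. V \<alpha>)"
  using assms by (auto simp: socle_filtration_def)

lemma le_ord_succD: "\<lbrakk>\<alpha> < ord_succ \<beta>; \<beta> < \<gamma>\<rbrakk> \<Longrightarrow> \<alpha> \<le> \<beta>"
  unfolding ord_succ_def using not_less_Least not_le by blast

text \<open>
  Monotonicity is part of the induction because the union at a limit is a submodule only for chains.
\<close>

lemma socle_filtration_submodule_mono: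
  fixes \<mu> \<alpha> :: "'o::wellorder"
  assumes M: "left_module R M" and V: "socle_filtration R \<X> M \<mu> V" and "\<alpha> \<le> \<mu>"
  shows "submodule (V \<alpha>) R M \<and> (\<forall>\<beta>\<le>\<alpha>. V \<beta> \<subseteq> V \<alpha>)"
  using \<open>\<alpha> \<le> \<mu>\<close>
proof (induction \<alpha> rule: less_induct)
  interpret left_module R M by fact
  case (less \<alpha>)
  show ?case
  proof (cases \<alpha> rule: ord_cases)
    case zero
    have "\<beta> = ord_zero" if "\<beta> \<le> ord_zero" for \<beta> :: 'o
      using that by (metis Least_le antisym ord_zero_def)
    then show ?thesis
      using zero zero_submodule socle_filtration_zero[OF V] by auto
  next
    case (succ \<beta>)
    then have \<beta>: "\<beta> < \<mu>" and sub: "submodule (V \<beta>) R M" and mono: "\<And>\<gamma>. \<gamma> \<le> \<beta> \<Longrightarrow> V \<gamma> \<subseteq> V \<beta>"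
      using less by auto
    interpret S: abelian_subgroup "V \<beta>" M by (rule submodule_abelian_subgroup[OF sub])
    interpret Q: left_module R "quot_module M (V \<beta>)" by (rule left_module_quot[OF sub])
    have eq: "V \<alpha> = {x \<in> carrier M. V \<beta> +>\<^bsub>M\<^esub> x \<in> soc R \<X> (quot_module M (V \<beta>))}"
      using socle_filtration_succ[OF V \<beta>] succ by simp
    have "submodule (V \<alpha>) R M"
      unfolding eq
      by (intro vimage_submodule[OF M Q.left_module_axioms coset_Hom[OF sub]] Q.soc_submodule)
    moreover have "V \<beta> \<subseteq> V \<alpha>"
      using Q.submodule_zero[OF Q.soc_submodule, of \<X>] submodule_subset[OF sub]
      by (auto simp: eq S.a_rcos_const quot_module_simps)
    moreover have "\<gamma> \<le> \<beta>" if "\<gamma> < \<alpha>" for \<gamma>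
      using that succ le_ord_succD by blast
    ultimately show ?thesis using mono by (metis order.trans order_le_less order_refl)
  next
    case limit
    then have eq: "V \<alpha> = (\<Union>\<beta>\<in>{..<\<alpha>}. V \<beta>)"
      using socle_filtration_limit[OF V] less.prems by blast
    have "submodule (\<Union>\<beta>\<in>{..<\<alpha>}. V \<beta>) R M"
    proof (rule Union_chain_submodule)
      show "{..<\<alpha>} \<noteq> {}" using limit by (auto simp: ord_limit_def)
      show "submodule (V \<beta>) R M" if "\<beta> \<in> {..<\<alpha>}" for \<beta>
        using that less by auto
      show "V \<beta> \<subseteq> V \<gamma> \<or> V \<gamma> \<subseteq> V \<beta>" if "\<beta> \<in> {..<\<alpha>}" "\<gamma> \<in> {..<\<alpha>}" for \<beta> \<gamma>
        using that less by (cases "\<beta> \<le> \<gamma>") auto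
    qed
    then show ?thesis using eq by (auto simp: order_le_less)
  qed
qed

lemmas socle_filtration_submodule = socle_filtration_submodule_mono[THEN conjunct1]

lemma socle_filtration_image_subset:
  assumes M: "left_module R M" and N: "left_module R N" and f: "f \<in> Hom R M N"
    and V: "socle_filtration R \<X> M \<mu> V" and W: "socle_filtration R \<X> N \<nu> W"
    and "\<alpha> \<le> \<mu>" "\<alpha> \<le> \<nu>"
  shows "f ` V \<alpha> \<subseteq> W \<alpha>"
  using \<open>\<alpha> \<le> \<mu>\<close> \<open>\<alpha> \<le> \<nu>\<close>
proof (induction \<alpha> rule: less_induct)
  interpret M: left_module R M by fact
  interpret N: left_module R N by fact
  case (less \<alpha>)
  show ?case
  proof (cases \<alpha> rule: ord_cases)
    case zero
    then show ?thesis
      using socle_filtration_zero[OF V] socle_filtration_zero[OF W] Hom_zero[OF M N f] by simp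
  next
    case (succ \<beta>)
    then have \<beta>: "\<beta> < \<mu>" "\<beta> < \<nu>" and sub: "f ` V \<beta> \<subseteq> W \<beta>"
      using less by auto
    have V\<beta>: "submodule (V \<beta>) R M" and W\<beta>: "submodule (W \<beta>) R N"
      using \<beta> socle_filtration_submodule[OF M V] socle_filtration_submodule[OF N W] by auto
    obtain g where g: "g \<in> Hom R (quot_module M (V \<beta>)) (quot_module N (W \<beta>))"
      and g_coset: "\<And>x. x \<in> carrier M \<Longrightarrow> g (V \<beta> +>\<^bsub>M\<^esub> x) = W \<beta> +>\<^bsub>N\<^esub> f x"
      using quot_Hom_lift[OF M N f V\<beta> W\<beta> sub] by blast
    have "g ` soc R \<X> (quot_module M (V \<beta>)) \<subseteq> soc R \<X> (quot_module N (W \<beta>))"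
      by (intro Hom_soc M.left_module_quot N.left_module_quot V\<beta> W\<beta> g)
    then show ?thesis
      using succ Hom_closed[OF f] g_coset
      by (auto simp: socle_filtration_succ[OF V \<beta>(1)] socle_filtration_succ[OF W \<beta>(2)]
          dest!: subsetD[OF _ imageI])
  next
    case limit
    then show ?thesis
      using less socle_filtration_limit[OF V _ limit] socle_filtration_limit[OF W _ limit]
      by (fastforce simp: image_subset_iff)
  qed
qed

theorem proposition3p8:
  fixes R :: "('a, 'r) ring_scheme"
    and \<X> :: "('a, 'x) module set"
    and M :: "('a, 'm) module"
    and N :: "('a, 'n) module"
    and \<mu> \<nu> :: "'o::wellorder"
    and V :: "'o \<Rightarrow> 'm set"
    and W :: "'o \<Rightarrow> 'n set"
    and f :: "'m \<Rightarrow> 'n"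
  assumes "ring R"
    and "semibrick R \<X>"
    and "M \<in> Filt TYPE('p::wellorder) R \<X>"
    and "N \<in> Filt TYPE('q::wellorder) R \<X>"
    and "f \<in> Hom R M N"
    and "socle_filtration R \<X> M \<mu> V"
    and "socle_filtration R \<X> N \<nu> W"
  shows "\<forall>\<alpha>\<le>\<mu>. f ` V \<alpha> \<subseteq> (if \<alpha> \<le> \<nu> then W \<alpha> else carrier N)"
proof (intro allI impI)
  fix \<alpha> assume \<alpha>: "\<alpha> \<le> \<mu>"
  have M: "left_module R M" and N: "left_module R N"
    using assms(3,4) by (auto simp: Filt_def)
  have "V \<alpha> \<subseteq> carrier M"
    by (rule left_module.submodule_subset[OF M socle_filtration_submodule[OF M assms(6) \<alpha>]])
  then show "f ` V \<alpha> \<subseteq> (if \<alpha> \<le> \<nu> then W \<alpha> else carrier N)"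
    using socle_filtration_image_subset[OF M N assms(5-7) \<alpha>] Hom_closed[OF assms(5)] by auto
qed

end
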